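(* Let $n\ge 1$, let $I_1,\dots,I_n$ be independent Bernoulli random variables with known parameters $p_i=P(I_i=1)\in[0,1]$, and let $w_1,\dots,w_n$ be positive real numbers, where $w_i$ is the payment a player receives for stopping on the last "1" of the sequence when this occurs in the variable $I_i$. Put $w_0:=0$ and define $$\mathbf{s}=\max\left\{k\in\{1,\dots,n\}:\ \sum_{j=k}^{n}\frac{w_j\,p_j}{1-p_j}\ \ge\ w_{k-1}\right\},$$ where a summand with $p_j=1$ is interpreted as $+\infty$. If the problem is monotone, then $\mathbf{s}$ is the optimal threshold. That is, to maximize the expected profit, it is optimal to stop on the first "1" encountered among the variables $I_{\mathbf{s}},I_{\mathbf{s}+1},\dots,I_n$. Furthermore, with this strategy the expected profit is $$\mathbb{E}=\begin{cases}\left(\prod_{j=\mathbf{s}}^{n}(1-p_j)\right)\sum_{i=\mathbf{s}}^{n}\dfrac{w_i\,p_i}{1-p_i}, & \text{if } p_{\mathbf{s}}<1,\\[2mm] w_{\mathbf{s}}\prod_{j=\mathbf{s}+1}^{n}(1-p_j), & \text{if } p_{\mathbf{s}}=1.\end{cases}$$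
   Context: The stopping problem: the independent Bernoulli variables $I_1,\dots,I_n$ are observed sequentially. At each index $k$, having observed $I_1,\dots,I_k$, the player may stop or continue, without knowledge of future values. If the player stops at index $k$ with $I_k=1$ and $I_{k+1}=\dots=I_n=0$ (so $k$ is the index of the last "1"), the profit is $w_k$; in every other case (including never stopping) the profit is $0$. The player wants to maximize the expected profit over all such stopping strategies. Empty products equal $1$ and empty sums equal $0$. Define, for $1\le k\le n$, $\mathbb{E}_{\mathrm{Stop}}(k):=w_k\prod_{i=k+1}^{n}(1-p_i)$ (the expected profit if we stop at the $k$-th event with $I_k=1$), and define $\mathbb{E}_{\mathrm{Keep}}(k)$ (the expected profit after observing the $k$-th event, not stopping there, and acting optimally later on) by $\mathbb{E}_{\mathrm{Keep}}(n)=0$ and, for $0\le k<n$, $$\mathbb{E}_{\mathrm{Keep}}(k)=p_{k+1}\max\{\mathbb{E}_{\mathrm{Stop}}(k+1),\mathbb{E}_{\mathrm{Keep}}(k+1)\}+(1-p_{k+1})\,\mathbb{E}_{\mathrm{Keep}}(k+1).$$ The stopping set is $\Upsilon_n:=\{k\in\{1,\dots,n\}:\mathbb{E}_{\mathrm{Stop}}(k)>\mathbb{E}_{\mathrm{Keep}}(k)\}$. The problem is called monotone if $\Upsilon_n=\{k\in\{1,\dots,n\}: k\ge \mathbf{k}\}$ for some $\mathbf{k}$; in that case $\mathbf{k}=\min\Upsilon_n$ is called the optimal threshold. *)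

theory Defs
  imports "HOL-Probability.Probability"
begin

text \<open>
  Parameters used throughout: the number n of observations, the success probabilities p, the
  payments w, and the observations I, all indexed by 1, ..., n. The value of an observation is a
  Boolean, with \<^const>\<open>True\<close> in the role of 1. A stopping strategy is a random
  time T with values in {1, ..., n} or \<open>\<infinity>\<close>, the latter meaning that the player never stops.
\<close>

text \<open>The information available at time t: what has been observed among the indices up to t.\<close>

definition natural_filtration ::
    "'a measure \<Rightarrow> nat \<Rightarrow> (nat \<Rightarrow> 'a \<Rightarrow> bool) \<Rightarrow> enat \<Rightarrow> 'a measure" where
  "natural_filtration M n I t =
     sigma (space M) {I i -` B \<inter> space M | i B. i \<in> {1..n} \<and> enat i \<le> t}"

definition strategy ::
    "'a measure \<Rightarrow> nat \<Rightarrow> (nat \<Rightarrow> 'a \<Rightarrow> bool) \<Rightarrow> ('a \<Rightarrow> enat) \<Rightarrow> bool" where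
  "strategy M n I T \<longleftrightarrow>
     stopping_time (natural_filtration M n I) T \<and>
     (\<forall>\<omega>\<in>space M. T \<omega> \<in> enat ` {1..n} \<union> {\<infinity>})"

definition profit ::
    "nat \<Rightarrow> (nat \<Rightarrow> real) \<Rightarrow> (nat \<Rightarrow> 'a \<Rightarrow> bool) \<Rightarrow> ('a \<Rightarrow> enat) \<Rightarrow> 'a \<Rightarrow> real" where
  "profit n w I T \<omega> =
     (case T \<omega> of
        enat k \<Rightarrow> if k \<in> {1..n} \<and> I k \<omega> \<and> (\<forall>j\<in>{k<..n}. \<not> I j \<omega>) then w k else 0
      | \<infinity> \<Rightarrow> 0)"

definition expected_profit ::
    "'a measure \<Rightarrow> nat \<Rightarrow> (nat \<Rightarrow> real) \<Rightarrow> (nat \<Rightarrow> 'a \<Rightarrow> bool) \<Rightarrow> ('a \<Rightarrow> enat) \<Rightarrow> real" where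
  "expected_profit M n w I T = (\<integral>\<omega>. profit n w I T \<omega> \<partial>M)"

definition optimal_strategy ::
    "'a measure \<Rightarrow> nat \<Rightarrow> (nat \<Rightarrow> real) \<Rightarrow> (nat \<Rightarrow> 'a \<Rightarrow> bool) \<Rightarrow> ('a \<Rightarrow> enat) \<Rightarrow> bool" where
  "optimal_strategy M n w I T \<longleftrightarrow>
     strategy M n I T \<and>
     (\<forall>T'. strategy M n I T' \<longrightarrow> expected_profit M n w I T' \<le> expected_profit M n w I T)"

text \<open>
  Stop on the first 1 among the indices k, ..., n. The infimum of the empty set is \<open>\<infinity>\<close>, so
  the player never stops if there is none.
\<close>

definition stop_on_first_one_from ::
    "nat \<Rightarrow> (nat \<Rightarrow> 'a \<Rightarrow> bool) \<Rightarrow> nat \<Rightarrow> 'a \<Rightarrow> enat" where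
  "stop_on_first_one_from n I k \<omega> = Inf (enat ` {i \<in> {k..n}. I i \<omega>})"

definition E_Stop :: "nat \<Rightarrow> (nat \<Rightarrow> real) \<Rightarrow> (nat \<Rightarrow> real) \<Rightarrow> nat \<Rightarrow> real" where
  "E_Stop n p w k = w k * (\<Prod>i\<in>{k+1..n}. 1 - p i)"

text \<open>Backward recursion. Only the values at k = 0, ..., n are meaningful.\<close>

function E_Keep :: "nat \<Rightarrow> (nat \<Rightarrow> real) \<Rightarrow> (nat \<Rightarrow> real) \<Rightarrow> nat \<Rightarrow> real" where
  "E_Keep n p w k =
     (if k < n
      then p (k+1) * max (E_Stop n p w (k+1)) (E_Keep n p w (k+1))
           + (1 - p (k+1)) * E_Keep n p w (k+1)
      else 0)"
  by auto
termination
  by (relation "Wellfounded.measure (\<lambda>(n, p, w, k). n - k)") auto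

declare E_Keep.simps [simp del]

definition stopping_set :: "nat \<Rightarrow> (nat \<Rightarrow> real) \<Rightarrow> (nat \<Rightarrow> real) \<Rightarrow> nat set" where
  "stopping_set n p w = {k \<in> {1..n}. E_Stop n p w k > E_Keep n p w k}"

definition monotone_problem :: "nat \<Rightarrow> (nat \<Rightarrow> real) \<Rightarrow> (nat \<Rightarrow> real) \<Rightarrow> bool" where
  "monotone_problem n p w \<longleftrightarrow> (\<exists>k. stopping_set n p w = {j \<in> {1..n}. j \<ge> k})"

text \<open>
  Meaningful for a monotone problem with n at least 1 and positive payments; the stopping set then
  contains n, because \<open>E_Stop n p w n = w n > 0 = E_Keep n p w n\<close>.
\<close>

definition optimal_threshold :: "nat \<Rightarrow> (nat \<Rightarrow> real) \<Rightarrow> (nat \<Rightarrow> real) \<Rightarrow> nat" where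
  "optimal_threshold n p w = Min (stopping_set n p w)"

definition weighted_odds :: "(nat \<Rightarrow> real) \<Rightarrow> (nat \<Rightarrow> real) \<Rightarrow> nat \<Rightarrow> ereal" where
  "weighted_odds p w j = (if p j = 1 then \<infinity> else ereal (w j * p j / (1 - p j)))"

text \<open>
  The update \<open>w(0 := 0)\<close> is the convention that the payment at index 0 is 0. With it, k = 1
  always belongs to the set if n is at least 1.
\<close>

definition odds_threshold :: "nat \<Rightarrow> (nat \<Rightarrow> real) \<Rightarrow> (nat \<Rightarrow> real) \<Rightarrow> nat" where
  "odds_threshold n p w =
     Max {k \<in> {1..n}. (\<Sum>j=k..n. weighted_odds p w j) \<ge> ereal ((w(0 := 0)) (k - 1))}"

end

theory Submission
  imports Defs
begin

text \<open>
  The proof separates a statement about stopping strategies from a computation with the backward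
  recursion.

  The statement about strategies is the principle of backward induction: stopping on the first 1
  in the stopping set is optimal, with value \<open>E_Keep 0\<close>. Whether the player stops at
  time k is decided by the observations up to k, which are independent of the later ones, so a
  stop at k on a 1 is worth \<open>E_Stop\<close> at k on average, and a stop on a 0 is worth
  nothing. Hence the expected profit of a strategy T is a sum of terms \<open>E_Stop k * prob (T =
  k, I k)\<close> (\<open>expected_profit_eq_sum_E_Stop\<close>). Backward induction on k shows
  that the part of this sum beyond k is at most \<open>E_Keep k * prob (T > k)\<close>
  (\<open>later_profit_le_E_Keep\<close>): the recursion for \<open>E_Keep\<close> takes the
  better of the two options at every 1. Stopping on the first 1 in the stopping set always takes
  the better option, so for this strategy every estimate is an equality
  (\<open>later_profit_stopping_set\<close>).

  For the computation, suppose that all indices after k belong to the stopping set and that no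
  observation after k is certain to be 1. Then the maximum in the recursion disappears, and
  \<open>E_Keep k\<close> is the probability that all later observations are 0 times the sum of
  the later weighted odds (\<open>E_Keep_eq_odds_sum\<close>). As \<open>E_Stop k\<close> is the
  same probability times \<open>w k\<close>, the index k is in the stopping set iff the sum of the
  weighted odds after k is less than \<open>w k\<close>; a later certain 1 makes the sum infinite
  and \<open>E_Stop k\<close> zero, which agrees with this criterion
  (\<open>stopping_set_iff_odds\<close>). In a monotone problem the stopping set is a final
  segment, so this criterion applies to all its elements and to the index just before it, and that
  is what the odds threshold tests. Finally, \<open>E_Keep\<close> does not change below the
  threshold, which turns \<open>E_Keep 0\<close> into the closed formula.
\<close>

section \<open>The backward recursion\<close>

lemma E_Keep_step:
  assumes "k < n"
  shows "E_Keep n p w k =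
    p (Suc k) * max (E_Stop n p w (Suc k)) (E_Keep n p w (Suc k))
      + (1 - p (Suc k)) * E_Keep n p w (Suc k)"
  using assms by (subst E_Keep.simps) simp

lemma E_Keep_last [simp]: "E_Keep n p w n = 0"
  by (subst E_Keep.simps) simp

text \<open>Waiting one index longer can only lose an opportunity to stop.\<close>

lemma E_Keep_antimono_step:
  assumes "k < n" and "\<And>i. i \<in> {1..n} \<Longrightarrow> 0 \<le> p i"
  shows "E_Keep n p w (Suc k) \<le> E_Keep n p w k"
proof -
  have "p (Suc k) * E_Keep n p w (Suc k)
      \<le> p (Suc k) * max (E_Stop n p w (Suc k)) (E_Keep n p w (Suc k))"
    using assms by (intro mult_left_mono) auto
  then show ?thesis
    using E_Keep_step[OF assms(1), of p w] by (simp add: algebra_simps)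
qed

lemma E_Keep_nonneg:
  assumes "k \<le> n" and "\<And>i. i \<in> {1..n} \<Longrightarrow> 0 \<le> p i"
  shows "0 \<le> E_Keep n p w k"
  using assms(1)
proof (induction k rule: inc_induct)
  case (step k)
  then show ?case
    using E_Keep_antimono_step[of k n p w] assms(2) by fastforce
qed simp

lemma E_Keep_eq_Suc_if_not_stopping:
  assumes "k < n" and "Suc k \<notin> stopping_set n p w"
  shows "E_Keep n p w k = E_Keep n p w (Suc k)"
  using assms E_Keep_step[OF assms(1), of p w]
  by (simp add: stopping_set_def max_absorb2 algebra_simps)

text \<open>
  If a later observation were certain to be 1, stopping at k would be worth 0, and k would not be
  in the stopping set. This is what makes the odds finite beyond the threshold.
\<close>

lemma stopping_set_later_uncertain:
  assumes "k \<in> stopping_set n p w" and "j \<in> {k+1..n}"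
    and p: "\<And>i. i \<in> {1..n} \<Longrightarrow> 0 \<le> p i \<and> p i \<le> 1"
  shows "p j < 1"
proof (rule ccontr)
  assume "\<not> p j < 1"
  then have "p j = 1"
    using assms(1,2) p[of j] by (auto simp: stopping_set_def)
  then have "E_Stop n p w k = 0"
    using assms(2) by (auto simp: E_Stop_def)
  then show False
    using assms(1) E_Keep_nonneg[of k n p w] p by (auto simp: stopping_set_def)
qed

text \<open>
  On a final segment of the stopping set, playing optimally means to stop on the first 1. This is
  profitable exactly if there is exactly one 1, and the probability that index i carries the only 1
  is the probability of no 1 at all times the odds of i.
\<close>

lemma E_Keep_eq_odds_sum:
  assumes "k \<le> n"
    and "{k+1..n} \<subseteq> stopping_set n p w"
    and "\<And>j. j \<in> {k+1..n} \<Longrightarrow> p j < 1"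
  shows "E_Keep n p w k = (\<Prod>j=k+1..n. 1 - p j) * (\<Sum>j=k+1..n. w j * p j / (1 - p j))"
  using assms
proof (induction k rule: inc_induct)
  case (step k)
  let ?P = "\<Prod>j=k+2..n. 1 - p j" and ?S = "\<Sum>j=k+2..n. w j * p j / (1 - p j)"
  have head: "{k+1..n} = insert (Suc k) {k+2..n}"
    using step.hyps by auto
  have "Suc k \<in> stopping_set n p w"
    using step.prems head by blast
  then have "E_Keep n p w k
      = p (Suc k) * E_Stop n p w (Suc k) + (1 - p (Suc k)) * E_Keep n p w (Suc k)"
    using E_Keep_step[OF step.hyps(2), of p w] by (simp add: stopping_set_def max_absorb1)
  also have "E_Stop n p w (Suc k) = w (Suc k) * ?P"
    by (simp add: E_Stop_def)
  also have "E_Keep n p w (Suc k) = ?P * ?S"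
    using step.IH step.prems by fastforce
  also have "p (Suc k) * (w (Suc k) * ?P) + (1 - p (Suc k)) * (?P * ?S)
      = ((1 - p (Suc k)) * ?P) * (w (Suc k) * p (Suc k) / (1 - p (Suc k)) + ?S)"
    using step.prems(2)[of "Suc k"] step.hyps by (simp add: field_simps)
  finally show ?case
    unfolding head by simp
qed simp

section \<open>The threshold\<close>

lemma sum_weighted_odds_uncertain:
  assumes "\<And>j. j \<in> A \<Longrightarrow> p j < 1"
  shows "(\<Sum>j\<in>A. weighted_odds p w j) = ereal (\<Sum>j\<in>A. w j * p j / (1 - p j))"
  using assms by (subst sum_ereal[symmetric], intro sum.cong refl) (fastforce simp: weighted_odds_def)

text \<open>
  If no later observation is certain, both sides compare \<open>E_Stop\<close> and \<open>E_Keep\<close> after division by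
  the positive probability of seeing no later 1. Otherwise this probability is 0; both sides are then
  false, because the sum is infinite.
\<close>

lemma stopping_set_iff_odds:
  assumes "k \<in> {1..n}"
    and p: "\<And>i. i \<in> {1..n} \<Longrightarrow> 0 \<le> p i \<and> p i \<le> 1"
    and tail: "{k+1..n} \<subseteq> stopping_set n p w"
  shows "k \<in> stopping_set n p w \<longleftrightarrow> (\<Sum>j=k+1..n. weighted_odds p w j) < ereal (w k)"
proof (cases "\<forall>j\<in>{k+1..n}. p j < 1")
  case True
  let ?P = "\<Prod>j=k+1..n. 1 - p j"
  have "?P > 0"
    using True by (intro prod_pos) auto
  moreover have "E_Keep n p w k = ?P * (\<Sum>j=k+1..n. w j * p j / (1 - p j))"
    using E_Keep_eq_odds_sum[of k n p w] assms True by simp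
  moreover have "E_Stop n p w k = ?P * w k"
    by (simp add: E_Stop_def)
  ultimately show ?thesis
    using assms(1) True sum_weighted_odds_uncertain[of "{k+1..n}" p w]
    by (simp add: stopping_set_def)
next
  case False
  then obtain j where j: "j \<in> {k+1..n}" "\<not> p j < 1"
    by blast
  then have "p j = 1"
    using p[of j] by simp
  then have "weighted_odds p w j = \<infinity>"
    by (simp add: weighted_odds_def)
  then have "(\<Sum>j=k+1..n. weighted_odds p w j) = \<infinity>"
    using j(1) by (auto simp: sum_Pinfty)
  moreover have "k \<notin> stopping_set n p w"
    using stopping_set_later_uncertain[of k n p w j] j p by blast
  ultimately show ?thesis
    by simp
qed

lemma monotone_problem_stopping_set:
  assumes "n \<ge> 1" and "w n > 0" and "monotone_problem n p w"
  shows "optimal_threshold n p w \<in> {1..n}"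
    and "stopping_set n p w = {optimal_threshold n p w..n}"
proof -
  let ?U = "stopping_set n p w"
  obtain k where k: "?U = {j \<in> {1..n}. j \<ge> k}"
    using assms(3) by (auto simp: monotone_problem_def)
  have "n \<in> ?U"
    using assms by (simp add: stopping_set_def E_Stop_def)
  then have "k \<le> n"
    using k by simp
  then have "max 1 k \<le> n"
    using assms(1) by simp
  have "{j \<in> {1..n}. j \<ge> k} = {max 1 k..n}"
    by auto
  then have U: "?U = {max 1 k..n}"
    using k by simp
  then have "optimal_threshold n p w = max 1 k"
    unfolding optimal_threshold_def U using \<open>max 1 k \<le> n\<close> by (intro Min_eqI) auto
  with U \<open>max 1 k \<le> n\<close> show "optimal_threshold n p w \<in> {1..n}"
    "?U = {optimal_threshold n p w..n}"
    by auto
qed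

lemma optimal_threshold_eq_odds_threshold:
  assumes "n \<ge> 1"
    and p: "\<And>i. i \<in> {1..n} \<Longrightarrow> 0 \<le> p i \<and> p i \<le> 1"
    and w: "\<And>i. i \<in> {1..n} \<Longrightarrow> w i > 0"
    and "monotone_problem n p w"
  shows "optimal_threshold n p w = odds_threshold n p w"
proof -
  define t where "t = optimal_threshold n p w"
  have t: "t \<in> {1..n}" and U: "stopping_set n p w = {t..n}"
    using monotone_problem_stopping_set[OF assms(1) w assms(4)] assms(1) by (simp_all add: t_def)
  \<comment> \<open>The odds criterion for k concerns the decision at k - 1. For k = 1 it holds because the
    payment at 0 is set to 0, and accordingly 0 is not in the stopping set.\<close>
  have odds_iff: "(\<Sum>j=k..n. weighted_odds p w j) \<ge> ereal ((w(0 := 0)) (k - 1))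
      \<longleftrightarrow> k - 1 \<notin> stopping_set n p w" if k: "k \<in> {t..n}" for k
  proof (cases "k = 1")
    case True
    have "0 \<le> (\<Sum>j=k..n. weighted_odds p w j)"
      using p w True by (intro sum_nonneg) (auto simp: weighted_odds_def less_imp_le)
    then show ?thesis
      using True by (simp add: stopping_set_def zero_ereal_def)
  next
    case False
    then obtain m where m: "k = Suc m" "m \<in> {1..n}"
      using k t by (cases k) auto
    have "{m+1..n} \<subseteq> stopping_set n p w"
      using k m by (simp add: U)
    then show ?thesis
      using stopping_set_iff_odds[of m n p w] p m by auto
  qed
  have "odds_threshold n p w = t"
    unfolding odds_threshold_def
  proof (rule Max_eqI)
    fix k
    assume "k \<in> {k \<in> {1..n}. (\<Sum>j=k..n. weighted_odds p w j) \<ge> ereal ((w(0 := 0)) (k - 1))}"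
    then show "k \<le> t"
      using odds_iff[of k] U by (cases "k \<le> t") auto
  next
    show "t \<in> {k \<in> {1..n}. (\<Sum>j=k..n. weighted_odds p w j) \<ge> ereal ((w(0 := 0)) (k - 1))}"
      using odds_iff[of t] U t by auto
  qed simp
  then show ?thesis
    by (simp add: t_def)
qed

text \<open>
  Below t the player always continues, so that nothing is gained before t and the value at 0 is the
  value just before t. Observation t itself may be certain to be 1; its odds are then infinite, but
  the player stops at t for sure, which has the value \<open>E_Stop\<close> at t.
\<close>

lemma E_Keep_0_eq_odds_formula:
  assumes t: "t \<in> {1..n}" and U: "stopping_set n p w = {t..n}"
    and p: "\<And>i. i \<in> {1..n} \<Longrightarrow> 0 \<le> p i \<and> p i \<le> 1"
  shows "E_Keep n p w 0 =
    (if p t < 1 then (\<Prod>j=t..n. 1 - p j) * (\<Sum>i=t..n. w i * p i / (1 - p i))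
     else w t * (\<Prod>j=t+1..n. 1 - p j))"
proof -
  have "E_Keep n p w 0 = E_Keep n p w k" if "k < t" for k
    using that
  proof (induction k)
    case (Suc k)
    then show ?case
      using E_Keep_eq_Suc_if_not_stopping[of k n p w] t U by simp
  qed simp
  moreover obtain m where m: "t = Suc m" "m < n"
    using t by (cases t) auto
  ultimately have start: "E_Keep n p w 0 = E_Keep n p w m"
    by simp
  have tU: "t \<in> stopping_set n p w"
    using U t by simp
  show ?thesis
  proof (cases "p t < 1")
    case True
    have "p j < 1" if "j \<in> {t..n}" for j
    proof (cases "j = t")
      case False
      then show ?thesis
        using stopping_set_later_uncertain[OF tU _ p] that by simp
    qed (use True in simp)
    then have "E_Keep n p w m = (\<Prod>j=t..n. 1 - p j) * (\<Sum>i=t..n. w i * p i / (1 - p i))"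
      using E_Keep_eq_odds_sum[of m n p w] m U by simp
    then show ?thesis
      using start True by simp
  next
    case False
    then have "p t = 1"
      using p[of t] t by simp
    then have "E_Keep n p w m = E_Stop n p w t"
      using E_Keep_step[OF m(2), of p w] tU by (simp add: m(1) stopping_set_def max_absorb1)
    then show ?thesis
      using False start by (simp add: E_Stop_def)
  qed
qed

section \<open>Stopping strategies for independent observations\<close>

locale bernoulli_observations = prob_space M
  for M :: "'a measure" +
  fixes n :: nat and I :: "nat \<Rightarrow> 'a \<Rightarrow> bool" and p :: "nat \<Rightarrow> real"
  assumes indep: "indep_vars (\<lambda>_. count_space UNIV) I {1..n}"
    and p_range: "i \<in> {1..n} \<Longrightarrow> 0 \<le> p i \<and> p i \<le> 1"
    and distr_I: "i \<in> {1..n} \<Longrightarrow>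
      distr M (count_space UNIV) (I i) = measure_pmf (bernoulli_pmf (p i))"
begin

abbreviation info :: "enat \<Rightarrow> 'a measure" where
  "info \<equiv> natural_filtration M n I"

lemma I_measurable: "i \<in> {1..n} \<Longrightarrow> I i \<in> M \<rightarrow>\<^sub>M count_space UNIV"
  using indep by (simp add: indep_vars_def2)

lemma prob_I:
  assumes "i \<in> {1..n}"
  shows "prob {\<omega> \<in> space M. I i \<omega>} = p i"
    and "prob {\<omega> \<in> space M. \<not> I i \<omega>} = 1 - p i"
proof -
  have *: "prob (I i -` B \<inter> space M) = measure (measure_pmf (bernoulli_pmf (p i))) B" for B
    using measure_distr[OF I_measurable[OF assms], of B] distr_I[OF assms] by simp
  show "prob {\<omega> \<in> space M. I i \<omega>} = p i"
    using *[of "{True}"] p_range[OF assms] by (simp add: measure_pmf_single vimage_def Int_def conj_commute)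
  show "prob {\<omega> \<in> space M. \<not> I i \<omega>} = 1 - p i"
    using *[of "{False}"] p_range[OF assms] by (simp add: measure_pmf_single vimage_def Int_def conj_commute)
qed

lemma space_info [simp]: "space (info t) = space M"
  by (simp add: natural_filtration_def space_measure_of_conv)

lemma sets_info:
  "sets (info t) = sigma_sets (space M)
     {I i -` B \<inter> space M | i B. i \<in> {1..n} \<and> enat i \<le> t}"
  unfolding natural_filtration_def by (subst sets_measure_of) auto

lemma sets_info_mono: "s \<le> t \<Longrightarrow> sets (info s) \<subseteq> sets (info t)"
  unfolding sets_info by (intro sigma_sets_mono') (auto intro: order_trans)

lemma observed_in_info:
  assumes "i \<in> {1..n}" and "enat i \<le> t"
  shows "{\<omega> \<in> space M. P (I i \<omega>)} \<in> sets (info t)"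
proof -
  have "{\<omega> \<in> space M. P (I i \<omega>)} = I i -` Collect P \<inter> space M"
    by auto
  then show ?thesis
    using assms unfolding sets_info by (intro sigma_sets.Basic CollectI exI conjI)
qed

lemma sets_info_subset_events: "sets (info t) \<subseteq> events"
  unfolding sets_info
  by (rule sets.sigma_sets_subset) (auto intro!: measurable_sets[OF I_measurable])

lemma strategyD:
  assumes "strategy M n I T"
  shows "\<And>t. {\<omega> \<in> space M. T \<omega> \<le> t} \<in> sets (info t)"
    and "\<And>t. {\<omega> \<in> space M. T \<omega> > t} \<in> sets (info t)"
proof -
  fix t
  have T: "stopping_time info T"
    using assms by (simp add: strategy_def)
  show "{\<omega> \<in> space M. T \<omega> \<le> t} \<in> sets (info t)"
    using stopping_timeD[OF T, of t] by (simp add: pred_def)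
  show "{\<omega> \<in> space M. T \<omega> > t} \<in> sets (info t)"
    using stopping_timeD2[OF T, of t] by (simp add: pred_def)
qed

lemma strategy_eq_in_info:
  assumes "strategy M n I T" and "k \<in> {1..n}"
  shows "{\<omega> \<in> space M. T \<omega> = enat k} \<in> sets (info (enat k))"
proof -
  have "{\<omega> \<in> space M. T \<omega> = enat k}
      = {\<omega> \<in> space M. T \<omega> \<le> enat k} - {\<omega> \<in> space M. T \<omega> \<le> enat (k - 1)}"
  proof -
    have "t = enat k \<longleftrightarrow> t \<le> enat k \<and> \<not> t \<le> enat (k - 1)" for t
      using assms(2) by (cases t) auto
    then show ?thesis
      by blast
  qed
  moreover have "{\<omega> \<in> space M. T \<omega> \<le> enat (k - 1)} \<in> sets (info (enat k))"
    using strategyD(1)[OF assms(1)] sets_info_mono[of "enat (k - 1)" "enat k"] by auto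
  ultimately show ?thesis
    using strategyD(1)[OF assms(1), of "enat k"] by auto
qed

text \<open>
  The observations up to k and those after k are two disjoint blocks of an independent family, hence
  generate independent sigma-algebras. The first one is the information at time k.
\<close>

lemma past_future_independent:
  assumes A: "A \<in> sets (info (enat k))"
    and B: "B \<in> sigma_sets (space M) (\<Union>i\<in>{k+1..n}. {I i -` C \<inter> space M | C. True})"
  shows "prob (A \<inter> B) = prob A * prob B"
proof -
  let ?E = "\<lambda>i. {I i -` C \<inter> space M | C. True}"
  \<comment> \<open>Only n variables are observed, so for k > n the first block ends at n.\<close>
  let ?J = "case_bool {1..min k n} {k+1..n}"
  have "indep_sets (\<lambda>b. sigma_sets (space M) (\<Union>i\<in>?J b. ?E i)) UNIV"
  proof (rule indep_sets_collect_sigma)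
    have "indep_sets ?E {1..n}"
      using indep by (simp add: indep_vars_def2)
    then show "indep_sets ?E (\<Union>b\<in>UNIV. ?J b)"
      by (rule indep_sets_mono_index[rotated]) (auto split: bool.splits)
    show "Int_stable (?E i)" for i
    proof (rule Int_stableI)
      fix A B
      assume "A \<in> ?E i" "B \<in> ?E i"
      then obtain C D where "A = I i -` C \<inter> space M" "B = I i -` D \<inter> space M"
        by blast
      then have "A \<inter> B = I i -` (C \<inter> D) \<inter> space M"
        by blast
      then show "A \<inter> B \<in> ?E i"
        by blast
    qed
    show "disjoint_family_on ?J UNIV"
      by (auto simp: disjoint_family_on_def split: bool.splits)
  qed
  then have "indep_set (sigma_sets (space M) (\<Union>i\<in>{1..min k n}. ?E i))
      (sigma_sets (space M) (\<Union>i\<in>{k+1..n}. ?E i))"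
    unfolding indep_set_def by (rule back_subst[of "\<lambda>F. indep_sets F UNIV"]) (auto split: bool.splits)
  moreover have "{I i -` B \<inter> space M | i B. i \<in> {1..n} \<and> enat i \<le> enat k}
      = (\<Union>i\<in>{i \<in> {1..n}. enat i \<le> enat k}. ?E i)"
    by blast
  moreover have "{i \<in> {1..n}. enat i \<le> enat k} = {1..min k n}"
    by auto
  ultimately show ?thesis
    using A B unfolding sets_info by (auto intro: indep_setD)
qed

lemma prob_past_next:
  assumes "k < n" and "A \<in> sets (info (enat k))"
  shows "prob {\<omega> \<in> A. I (Suc k) \<omega>} = prob A * p (Suc k)"
    and "prob {\<omega> \<in> A. \<not> I (Suc k) \<omega>} = prob A * (1 - p (Suc k))"
proof -
  have *: "{\<omega> \<in> space M. P (I (Suc k) \<omega>)}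
      \<in> sigma_sets (space M) (\<Union>i\<in>{k+1..n}. {I i -` C \<inter> space M | C. True})" for P
  proof (rule sigma_sets.Basic)
    have "{\<omega> \<in> space M. P (I (Suc k) \<omega>)} = I (Suc k) -` Collect P \<inter> space M"
      by auto
    then have "{\<omega> \<in> space M. P (I (Suc k) \<omega>)} \<in> {I (Suc k) -` C \<inter> space M | C. True}"
      by blast
    then show "{\<omega> \<in> space M. P (I (Suc k) \<omega>)} \<in> (\<Union>i\<in>{k+1..n}. {I i -` C \<inter> space M | C. True})"
      using assms(1) by (intro UN_I[of "Suc k"]) simp_all
  qed
  have A: "A \<subseteq> space M"
    using sets.sets_into_space[OF assms(2)] by simp
  have "{\<omega> \<in> A. P (I (Suc k) \<omega>)} = A \<inter> {\<omega> \<in> space M. P (I (Suc k) \<omega>)}" for P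
    using A by auto
  then have "prob {\<omega> \<in> A. P (I (Suc k) \<omega>)} = prob A * prob {\<omega> \<in> space M. P (I (Suc k) \<omega>)}" for P
    using past_future_independent[OF assms(2) *] by simp
  from this[of "\<lambda>x. x"] this[of Not]
  show "prob {\<omega> \<in> A. I (Suc k) \<omega>} = prob A * p (Suc k)"
    "prob {\<omega> \<in> A. \<not> I (Suc k) \<omega>} = prob A * (1 - p (Suc k))"
    using prob_I[of "Suc k"] assms(1) by simp_all
qed

text \<open>
  After one more 0 the event is part of the information at the next time, so the factors can be
  split off one by one.
\<close>

lemma prob_past_no_later_one:
  assumes "k \<le> n" and "A \<in> sets (info (enat k))"
  shows "prob {\<omega> \<in> A. \<forall>j\<in>{k<..n}. \<not> I j \<omega>} = prob A * (\<Prod>j=k+1..n. 1 - p j)"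
  using assms
proof (induction k arbitrary: A rule: inc_induct)
  case (step k)
  have "A \<subseteq> space M"
    using sets.sets_into_space[OF step.prems] by simp
  then have "{\<omega> \<in> A. \<not> I (Suc k) \<omega>} = A \<inter> {\<omega> \<in> space M. \<not> I (Suc k) \<omega>}"
    by auto
  then have "{\<omega> \<in> A. \<not> I (Suc k) \<omega>} \<in> sets (info (enat (Suc k)))"
    using step.prems step.hyps sets_info_mono[of "enat k" "enat (Suc k)"]
      observed_in_info[of "Suc k" "enat (Suc k)" Not] by auto
  note step.IH[OF this]
  moreover have "{k<..n} = insert (Suc k) {Suc k<..n}" "{k+1..n} = insert (Suc k) {Suc k+1..n}"
    using step.hyps by auto
  moreover from this have "{\<omega> \<in> A. \<forall>j\<in>{k<..n}. \<not> I j \<omega>}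
      = {\<omega> \<in> {\<omega> \<in> A. \<not> I (Suc k) \<omega>}. \<forall>j\<in>{Suc k<..n}. \<not> I j \<omega>}"
    by auto
  ultimately show ?case
    using prob_past_next(2)[OF step.hyps(2) step.prems] by simp
qed simp

text \<open>
  The profit is \<open>w k\<close> on the event that the player stops at k on a 1 and no 1 follows. The first part
  of this event is known at time k and the second part lies in the future, so its probability
  factors, and \<open>w k\<close> times the future factor is \<open>E_Stop\<close> at k.
\<close>

lemma expected_profit_eq_sum_E_Stop:
  assumes T: "strategy M n I T"
  shows "expected_profit M n w I T =
    (\<Sum>k=1..n. E_Stop n p w k * prob {\<omega> \<in> space M. T \<omega> = enat k \<and> I k \<omega>})"
proof -
  let ?H = "\<lambda>k. {\<omega> \<in> space M. T \<omega> = enat k \<and> I k \<omega>}"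
  let ?W = "\<lambda>k. {\<omega> \<in> ?H k. \<forall>j\<in>{k<..n}. \<not> I j \<omega>}"
  have H: "?H k \<in> sets (info (enat k))" if "k \<in> {1..n}" for k
  proof -
    have "?H k = {\<omega> \<in> space M. T \<omega> = enat k} \<inter> {\<omega> \<in> space M. I k \<omega>}"
      by auto
    then show ?thesis
      using strategy_eq_in_info[OF T that] observed_in_info[OF that, of "enat k" "\<lambda>x. x"] by auto
  qed
  have W: "?W k \<in> events" if "k \<in> {1..n}" for k
  proof -
    have "{\<omega> \<in> space M. \<not> I j \<omega>} \<in> events" if "j \<in> {k<..n}" for j
      using observed_in_info[of j "enat j" Not] sets_info_subset_events that \<open>k \<in> {1..n}\<close> by auto
    then have "{\<omega> \<in> space M. \<forall>j\<in>{k<..n}. \<not> I j \<omega>} \<in> events"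
      by (intro sets.sets_Collect_finite_All) auto
    moreover have "?H k \<in> events"
      using H[OF that] sets_info_subset_events by blast
    ultimately have "?H k \<inter> {\<omega> \<in> space M. \<forall>j\<in>{k<..n}. \<not> I j \<omega>} \<in> events"
      by (intro sets.Int)
    also have "?H k \<inter> {\<omega> \<in> space M. \<forall>j\<in>{k<..n}. \<not> I j \<omega>} = ?W k"
      by blast
    finally show ?thesis .
  qed
  have profit: "profit n w I T \<omega> = (\<Sum>k=1..n. w k * indicat_real (?W k) \<omega>)"
    if "\<omega> \<in> space M" for \<omega>
  proof (cases "T \<omega>")
    case (enat k)
    then have "(\<Sum>j=1..n. w j * indicat_real (?W j) \<omega>)
        = (\<Sum>j=1..n. if j = k then w k * indicat_real (?W k) \<omega> else 0)"
      by (intro sum.cong) (auto simp: indicator_def)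
    then show ?thesis
      using enat that by (auto simp: profit_def indicator_def)
  qed (simp add: profit_def)
  have "expected_profit M n w I T = (\<integral>\<omega>. (\<Sum>k=1..n. w k * indicat_real (?W k) \<omega>) \<partial>M)"
    unfolding expected_profit_def by (intro Bochner_Integration.integral_cong refl profit)
  also have "\<dots> = (\<Sum>k=1..n. w k * prob (?W k))"
  proof -
    have "integrable M (\<lambda>\<omega>. w k * indicat_real (?W k) \<omega>)" if "k \<in> {1..n}" for k
      using W[OF that] by (intro integrable_mult_right integrable_real_indicator)
        (auto simp: less_top[symmetric])
    then have "(\<integral>\<omega>. (\<Sum>k=1..n. w k * indicat_real (?W k) \<omega>) \<partial>M)
        = (\<Sum>k=1..n. \<integral>\<omega>. w k * indicat_real (?W k) \<omega> \<partial>M)"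
      by (intro Bochner_Integration.integral_sum)
    also have "\<dots> = (\<Sum>k=1..n. w k * prob (?W k))"
      using W by (intro sum.cong refl) (simp add: Int_absorb2 sets.sets_into_space)
    finally show ?thesis .
  qed
  also have "\<dots> = (\<Sum>k=1..n. E_Stop n p w k * prob (?H k))"
    using prob_past_no_later_one[OF _ H] by (intro sum.cong refl) (simp add: E_Stop_def)
  finally show ?thesis .
qed

text \<open>
  A player who is still active after time k has four possibilities at the next index: stop or go on,
  on a 1 or on a 0. The decision not to stop by time k is independent of the next observation, which
  fixes the total probability of the two possibilities for each value of that observation.
\<close>

lemma active_after_step_probabilities:
  assumes T: "strategy M n I T" and k: "k < n"
  defines "a \<equiv> prob {\<omega> \<in> space M. T \<omega> = enat (Suc k) \<and> I (Suc k) \<omega>}"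
    and "b \<equiv> prob {\<omega> \<in> space M. T \<omega> > enat (Suc k) \<and> I (Suc k) \<omega>}"
    and "c \<equiv> prob {\<omega> \<in> space M. T \<omega> > enat (Suc k) \<and> \<not> I (Suc k) \<omega>}"
    and "d \<equiv> prob {\<omega> \<in> space M. T \<omega> = enat (Suc k) \<and> \<not> I (Suc k) \<omega>}"
    and "q \<equiv> prob {\<omega> \<in> space M. T \<omega> > enat k}"
  shows "a + b = q * p (Suc k)" "c + d = q * (1 - p (Suc k))"
    and "prob {\<omega> \<in> space M. T \<omega> > enat (Suc k)} = b + c"
proof -
  have later: "enat k < t \<longleftrightarrow> t = enat (Suc k) \<or> enat (Suc k) < t" for t
    by (cases t) auto
  have gt: "{\<omega> \<in> space M. T \<omega> > enat j} \<in> events" for j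
    using strategyD(2)[OF T] sets_info_subset_events by blast
  have eq: "{\<omega> \<in> space M. T \<omega> = enat (Suc k)} \<in> events"
    using strategy_eq_in_info[OF T, of "Suc k"] k sets_info_subset_events by auto
  have one: "{\<omega> \<in> space M. I (Suc k) \<omega>} \<in> events" "{\<omega> \<in> space M. \<not> I (Suc k) \<omega>} \<in> events"
    using observed_in_info[of "Suc k" "enat (Suc k)" "\<lambda>x. x"]
      observed_in_info[of "Suc k" "enat (Suc k)" Not] k sets_info_subset_events by auto
  have ev: "{\<omega> \<in> space M. T \<omega> = enat (Suc k) \<and> I (Suc k) \<omega>} \<in> events"
    "{\<omega> \<in> space M. T \<omega> = enat (Suc k) \<and> \<not> I (Suc k) \<omega>} \<in> events"
    "{\<omega> \<in> space M. T \<omega> > enat (Suc k) \<and> I (Suc k) \<omega>} \<in> events"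
    "{\<omega> \<in> space M. T \<omega> > enat (Suc k) \<and> \<not> I (Suc k) \<omega>} \<in> events"
    using gt[of "Suc k"] eq one by (auto intro: sets.sets_Collect_conj)
  have "{\<omega> \<in> {\<omega> \<in> space M. T \<omega> > enat k}. I (Suc k) \<omega>}
      = {\<omega> \<in> space M. T \<omega> = enat (Suc k) \<and> I (Suc k) \<omega>}
        \<union> {\<omega> \<in> space M. T \<omega> > enat (Suc k) \<and> I (Suc k) \<omega>}"
    using later by auto
  then show "a + b = q * p (Suc k)"
    using prob_past_next(1)[OF k strategyD(2)[OF T]] ev unfolding a_def b_def q_def
    by (subst finite_measure_Union[symmetric]) auto
  have "{\<omega> \<in> {\<omega> \<in> space M. T \<omega> > enat k}. \<not> I (Suc k) \<omega>}
      = {\<omega> \<in> space M. T \<omega> > enat (Suc k) \<and> \<not> I (Suc k) \<omega>}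
        \<union> {\<omega> \<in> space M. T \<omega> = enat (Suc k) \<and> \<not> I (Suc k) \<omega>}"
    using later by auto
  then show "c + d = q * (1 - p (Suc k))"
    using prob_past_next(2)[OF k strategyD(2)[OF T]] ev unfolding c_def d_def q_def
    by (subst finite_measure_Union[symmetric]) auto
  have "{\<omega> \<in> space M. T \<omega> > enat (Suc k)}
      = {\<omega> \<in> space M. T \<omega> > enat (Suc k) \<and> I (Suc k) \<omega>}
        \<union> {\<omega> \<in> space M. T \<omega> > enat (Suc k) \<and> \<not> I (Suc k) \<omega>}"
    by auto
  then show "prob {\<omega> \<in> space M. T \<omega> > enat (Suc k)} = b + c"
    using ev unfolding b_def c_def by (subst finite_measure_Union[symmetric]) auto
qed

text \<open>
  At the next index a strategy may lose against the recursion in two ways: by taking the worse option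
  on a 1, or by stopping on a 0, which forgoes the nonnegative value of continuing.
\<close>

lemma later_profit_le_E_Keep:
  assumes T: "strategy M n I T" and "k \<le> n"
  shows "(\<Sum>j=k+1..n. E_Stop n p w j * prob {\<omega> \<in> space M. T \<omega> = enat j \<and> I j \<omega>})
    \<le> E_Keep n p w k * prob {\<omega> \<in> space M. T \<omega> > enat k}"
  using assms(2)
proof (induction k rule: inc_induct)
  case (step k)
  let ?S = "E_Stop n p w (Suc k)" and ?K = "E_Keep n p w (Suc k)"
  let ?a = "prob {\<omega> \<in> space M. T \<omega> = enat (Suc k) \<and> I (Suc k) \<omega>}"
  let ?b = "prob {\<omega> \<in> space M. T \<omega> > enat (Suc k) \<and> I (Suc k) \<omega>}"
  let ?c = "prob {\<omega> \<in> space M. T \<omega> > enat (Suc k) \<and> \<not> I (Suc k) \<omega>}"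
  let ?q = "prob {\<omega> \<in> space M. T \<omega> > enat k}"
  note split = active_after_step_probabilities[OF T step.hyps(2)]
  have "0 \<le> ?K"
    using E_Keep_nonneg[of "Suc k" n p w] p_range step.hyps by simp
  have "{k+1..n} = insert (Suc k) {Suc k+1..n}"
    using step.hyps by auto
  then have "(\<Sum>j=k+1..n. E_Stop n p w j * prob {\<omega> \<in> space M. T \<omega> = enat j \<and> I j \<omega>})
      \<le> ?S * ?a + ?K * (?b + ?c)"
    using step.IH unfolding split(3) by simp
  \<comment> \<open>On a 1, both options are bounded by the better one.\<close>
  also have "\<dots> \<le> max ?S ?K * ?a + (max ?S ?K * ?b + ?K * ?c)"
    unfolding distrib_left by (intro add_mono mult_right_mono) auto
  also have "\<dots> = max ?S ?K * (?a + ?b) + ?K * ?c"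
    by (simp add: algebra_simps)
  \<comment> \<open>On a 0, the event of having stopped is added to the event of going on.\<close>
  also have "\<dots> \<le> max ?S ?K * (?q * p (Suc k)) + ?K * (?q * (1 - p (Suc k)))"
    unfolding split(1) split(2)[symmetric] using \<open>0 \<le> ?K\<close> by (intro add_left_mono mult_left_mono) auto
  also have "\<dots> = E_Keep n p w k * ?q"
    by (simp add: E_Keep_step[OF step.hyps(2)] algebra_simps)
  finally show ?case .
qed simp

corollary expected_profit_le_E_Keep_0:
  assumes T: "strategy M n I T"
  shows "expected_profit M n w I T \<le> E_Keep n p w 0"
proof -
  have "expected_profit M n w I T \<le> E_Keep n p w 0 * prob {\<omega> \<in> space M. T \<omega> > enat 0}"
    using later_profit_le_E_Keep[OF T, of 0 w] expected_profit_eq_sum_E_Stop[OF T, of w] by simp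
  also have "\<dots> \<le> E_Keep n p w 0"
    using E_Keep_nonneg[of 0 n p w] p_range by (simp add: mult_left_le)
  finally show ?thesis .
qed

text \<open>
  The candidates for stopping may form any set of indices here, so that the optimal strategy can be
  described before monotonicity makes the stopping set a final segment.
\<close>

definition first_one_in :: "nat set \<Rightarrow> 'a \<Rightarrow> enat" where
  "first_one_in U \<omega> = Inf (enat ` {i \<in> U. I i \<omega>})"

lemma first_one_in_le_iff:
  "first_one_in U \<omega> \<le> enat k \<longleftrightarrow> (\<exists>i\<in>U. i \<le> k \<and> I i \<omega>)"
proof -
  \<comment> \<open>A strict bound on an infimum is witnessed by an element; a weak bound in general is not.\<close>
  have "t \<le> enat k \<longleftrightarrow> t < enat (Suc k)" for t
    by (cases t) auto
  then have "first_one_in U \<omega> \<le> enat k \<longleftrightarrow> first_one_in U \<omega> < enat (Suc k)" .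
  also have "\<dots> \<longleftrightarrow> (\<exists>i\<in>U. i < Suc k \<and> I i \<omega>)"
    unfolding first_one_in_def Inf_less_iff by auto
  finally show ?thesis
    by (simp only: less_Suc_eq_le)
qed

lemma first_one_in_values: "first_one_in U \<omega> \<in> enat ` {i \<in> U. I i \<omega>} \<union> {\<infinity>}"
proof (cases "{i \<in> U. I i \<omega>} = {}")
  case True
  then show ?thesis
    unfolding first_one_in_def True by (simp add: top_enat_def)
next
  case False
  then show ?thesis
    using wellorder_InfI[of _ "enat ` {i \<in> U. I i \<omega>}"] unfolding first_one_in_def by blast
qed

lemma strategy_first_one_in:
  assumes "U \<subseteq> {1..n}"
  shows "strategy M n I (first_one_in U)"
  unfolding strategy_def
proof
  show "stopping_time info (first_one_in U)"
  proof
    fix t :: enat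
    show "Measurable.pred (info t) (\<lambda>\<omega>. first_one_in U \<omega> \<le> t)"
    proof (cases t)
      case (enat k)
      have "{\<omega> \<in> space M. first_one_in U \<omega> \<le> t}
          = (\<Union>i\<in>{i \<in> U. i \<le> k}. {\<omega> \<in> space M. I i \<omega>})"
        by (auto simp: enat first_one_in_le_iff)
      also have "\<dots> \<in> sets (info t)"
        using assms by (intro sets.finite_UN observed_in_info[of _ _ "\<lambda>x. x"])
          (auto simp: enat intro: finite_subset)
      finally show ?thesis
        by (simp add: pred_def)
    qed simp
  qed
  show "\<forall>\<omega>\<in>space M. first_one_in U \<omega> \<in> enat ` {1..n} \<union> {\<infinity>}"
    using first_one_in_values[of U] assms by blast
qed

text \<open>
  Neither loss occurs for this strategy: it never stops on a 0, and on a 1 at index k it stops iff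
  stopping at k is worth more than continuing.
\<close>

lemma later_profit_stopping_set:
  fixes w :: "nat \<Rightarrow> real" and k :: nat
  assumes "k \<le> n"
  defines "T \<equiv> first_one_in (stopping_set n p w)"
  shows "(\<Sum>j=k+1..n. E_Stop n p w j * prob {\<omega> \<in> space M. T \<omega> = enat j \<and> I j \<omega>})
    = E_Keep n p w k * prob {\<omega> \<in> space M. T \<omega> > enat k}"
  using assms(1)
proof (induction k rule: inc_induct)
  case base
  have "T \<omega> = \<infinity>" if "T \<omega> > enat n" for \<omega>
    using that first_one_in_values[of "stopping_set n p w" \<omega>]
    by (auto simp: T_def stopping_set_def)
  then show ?case
    by simp
next
  case (step k)
  let ?U = "stopping_set n p w"
  let ?S = "E_Stop n p w (Suc k)" and ?K = "E_Keep n p w (Suc k)"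
  let ?a = "prob {\<omega> \<in> space M. T \<omega> = enat (Suc k) \<and> I (Suc k) \<omega>}"
  let ?b = "prob {\<omega> \<in> space M. T \<omega> > enat (Suc k) \<and> I (Suc k) \<omega>}"
  let ?c = "prob {\<omega> \<in> space M. T \<omega> > enat (Suc k) \<and> \<not> I (Suc k) \<omega>}"
  let ?q = "prob {\<omega> \<in> space M. T \<omega> > enat k}"
  have T: "strategy M n I T"
    unfolding T_def by (intro strategy_first_one_in) (auto simp: stopping_set_def)
  note split = active_after_step_probabilities[OF T step.hyps(2)]
  have stop: "Suc k \<in> ?U \<and> I (Suc k) \<omega>" if "T \<omega> = enat (Suc k)" for \<omega>
    using that first_one_in_values[of ?U \<omega>] by (auto simp: T_def)
  have "?S * ?a + ?K * ?b = max ?S ?K * (?a + ?b)"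
  proof (cases "Suc k \<in> ?U")
    case True
    then have "T \<omega> \<le> enat (Suc k)" if "I (Suc k) \<omega>" for \<omega>
      using that by (auto simp: T_def first_one_in_le_iff)
    then have "{\<omega> \<in> space M. T \<omega> > enat (Suc k) \<and> I (Suc k) \<omega>} = {}"
      by (force simp: not_le)
    then have "?b = 0"
      by (simp only: measure_empty)
    then show ?thesis
      using True by (simp add: stopping_set_def max_absorb1)
  next
    case False
    then have "{\<omega> \<in> space M. T \<omega> = enat (Suc k) \<and> I (Suc k) \<omega>} = {}"
      using stop by blast
    then have "?a = 0"
      by (simp only: measure_empty)
    then show ?thesis
      using False step.hyps by (simp add: stopping_set_def max_absorb2)
  qed
  moreover have "?c = ?q * (1 - p (Suc k))"
  proof -
    have "{\<omega> \<in> space M. T \<omega> = enat (Suc k) \<and> \<not> I (Suc k) \<omega>} = {}"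
      using stop by blast
    then show ?thesis
      using split(2) by (simp only: measure_empty add_0_right)
  qed
  moreover have "{k+1..n} = insert (Suc k) {Suc k+1..n}"
    using step.hyps by auto
  then have "(\<Sum>j=k+1..n. E_Stop n p w j * prob {\<omega> \<in> space M. T \<omega> = enat j \<and> I j \<omega>})
      = ?S * ?a + ?K * (?b + ?c)"
    using step.IH unfolding split(3) by simp
  ultimately have "(\<Sum>j=k+1..n. E_Stop n p w j * prob {\<omega> \<in> space M. T \<omega> = enat j \<and> I j \<omega>})
      = max ?S ?K * (?q * p (Suc k)) + ?K * (?q * (1 - p (Suc k)))"
    using split(1) by (simp add: distrib_left)
  also have "\<dots> = E_Keep n p w k * ?q"
    by (simp add: E_Keep_step[OF step.hyps(2)] algebra_simps)
  finally show ?case .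
qed

theorem first_one_in_stopping_set_optimal:
  shows "expected_profit M n w I (first_one_in (stopping_set n p w)) = E_Keep n p w 0"
    and "optimal_strategy M n w I (first_one_in (stopping_set n p w))"
proof -
  let ?T = "first_one_in (stopping_set n p w)"
  have T: "strategy M n I ?T"
    by (intro strategy_first_one_in) (auto simp: stopping_set_def)
  \<comment> \<open>Indices start at 1, so the player is certainly active after time 0.\<close>
  have "?T \<omega> > enat 0" for \<omega>
    unfolding not_le[symmetric] first_one_in_le_iff by (auto simp: stopping_set_def)
  then show *: "expected_profit M n w I ?T = E_Keep n p w 0"
    using later_profit_stopping_set[of 0 w] expected_profit_eq_sum_E_Stop[OF T, of w]
    by (simp add: prob_space)
  show "optimal_strategy M n w I ?T"
    using T expected_profit_le_E_Keep_0 by (simp add: optimal_strategy_def *)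
qed

end

section \<open>Optimality of the odds threshold\<close>

theorem theorem2:
  fixes M :: "'a measure" and n :: nat and I :: "nat \<Rightarrow> 'a \<Rightarrow> bool"
    and p w :: "nat \<Rightarrow> real" and s :: nat
  assumes "prob_space M"
    and "n \<ge> 1"
    and "prob_space.indep_vars M (\<lambda>_. count_space UNIV) I {1..n}"
    and "\<And>i. i \<in> {1..n} \<Longrightarrow> 0 \<le> p i \<and> p i \<le> 1"
    and "\<And>i. i \<in> {1..n} \<Longrightarrow> distr M (count_space UNIV) (I i) = measure_pmf (bernoulli_pmf (p i))"
    and "\<And>i. i \<in> {1..n} \<Longrightarrow> w i > 0"
    and "s = odds_threshold n p w"
    and "monotone_problem n p w"
  shows "optimal_threshold n p w = s
    \<and> optimal_strategy M n w I (stop_on_first_one_from n I s)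
    \<and> expected_profit M n w I (stop_on_first_one_from n I s) =
        (if p s < 1 then (\<Prod>j=s..n. 1 - p j) * (\<Sum>i=s..n. w i * p i / (1 - p i))
         else w s * (\<Prod>j=s+1..n. 1 - p j))"
proof -
  interpret bernoulli_observations M n I p
  proof (rule bernoulli_observations.intro)
    show "prob_space M"
      by (fact assms(1))
    show "bernoulli_observations_axioms M n I p"
    proof
      show "prob_space.indep_vars M (\<lambda>_. count_space UNIV) I {1..n}"
        by (fact assms(3))
      show "0 \<le> p i \<and> p i \<le> 1" if "i \<in> {1..n}" for i
        using that by (fact assms(4))
      show "distr M (count_space UNIV) (I i) = measure_pmf (bernoulli_pmf (p i))"
        if "i \<in> {1..n}" for i
        using that by (fact assms(5))
    qed
  qed
  have s: "optimal_threshold n p w = s"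
    unfolding assms(7)
    by (rule optimal_threshold_eq_odds_threshold) (fact assms)+
  have "w n > 0"
    by (rule assms(6)) (use assms(2) in simp)
  note U = monotone_problem_stopping_set[OF assms(2) this assms(8), unfolded s]
  have T: "stop_on_first_one_from n I s = first_one_in (stopping_set n p w)"
    unfolding U(2) by (intro ext) (simp only: stop_on_first_one_from_def first_one_in_def)
  have profit_value: "E_Keep n p w 0 =
      (if p s < 1 then (\<Prod>j=s..n. 1 - p j) * (\<Sum>i=s..n. w i * p i / (1 - p i))
       else w s * (\<Prod>j=s+1..n. 1 - p j))"
    using U by (rule E_Keep_0_eq_odds_formula) (fact assms(4))
  show ?thesis
    unfolding T profit_value[symmetric]
    by (intro conjI s first_one_in_stopping_set_optimal)
qed

end
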